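(* Let $(S,\Sigma,\mu)$ be a positive measure space, let $X$ be a complex smooth Banach space, and let $G$ be a (complex linear, not necessarily closed) subspace of $L^{1}(\mu,X)$. Let $f\in L^{1}(\mu,X)\setminus\overline{G}$ and $g_0\in G$. Then $g_0\in\mathcal{P}_G(f)$ if and only if $$\left|\int_{Z(f-g_0)^c}\operatorname{Re}\big(F_{f(s)-g_0(s)}(g(s))\big)\,d\mu(s)\right|\le\int_{Z(f-g_0)}\|g(s)\|\,d\mu(s)\quad\text{for all } g\in G.$$
   Context: For a positive measure space $(S,\Sigma,\mu)$ and a Banach space $X$, $L^{1}(\mu,X)$ is the Lebesgue-Bochner space of (classes modulo a.e. equality of) strongly measurable functions $f:S\to X$ with $\|f\|_1=\int_S\|f(s)\|\,d\mu(s)<\infty$. For $0\neq x\in X$, a support map $F_x$ at $x$ is a bounded linear functional on $X$ with $\|F_x\|=1$ and $F_x(x)=\|x\|$; $X$ is smooth if for each $x\ne 0$ the support map $F_x$ is unique. For a function $h:S\to X$, $Z(h)=\{s\in S: h(s)=0\}$ and $Z(h)^c$ is its complement in $S$. For a subspace $G$ of a normed space $E$ and $f\in E$, $\mathcal{P}_G(f)$ is the set of best approximants of $f$ in $G$, i.e. the set of $g_0\in G$ with $\|f-g_0\|=\inf\{\|f-g\|:g\in G\}$. *)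

theory Defs
  imports "HOL-Analysis.Analysis"
begin

section \<open>Complex Banach spaces\<close>

class complex_normed_vector = real_normed_vector +
  fixes scaleC :: "complex \<Rightarrow> 'a \<Rightarrow> 'a" (infixr \<open>*\<^sub>C\<close> 75)
  assumes scaleC_add_right: "a *\<^sub>C (x + y) = a *\<^sub>C x + a *\<^sub>C y"
    and scaleC_add_left: "(a + b) *\<^sub>C x = a *\<^sub>C x + b *\<^sub>C x"
    and scaleC_scaleC: "a *\<^sub>C b *\<^sub>C x = (a * b) *\<^sub>C x"
    and scaleC_of_real: "complex_of_real r *\<^sub>C x = r *\<^sub>R x"
    and norm_scaleC: "norm (a *\<^sub>C x) = cmod a * norm x"

class complex_banach = complex_normed_vector + banach

section \<open>Support maps and smoothness\<close>

text \<open>The library's \<^const>\<open>onorm\<close> is the supremum of \<open>\<parallel>F y\<parallel> / \<parallel>y\<parallel>\<close>; it does not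
  depend on whether \<open>F\<close> is regarded as a real or as a complex linear map.\<close>

definition is_support_map :: "'a::complex_normed_vector \<Rightarrow> ('a \<Rightarrow> complex) \<Rightarrow> bool" where
  "is_support_map x F \<longleftrightarrow>
     bounded_linear F \<and> (\<forall>c y. F (c *\<^sub>C y) = c * F y) \<and>
     onorm F = 1 \<and> F x = complex_of_real (norm x)"

text \<open>Existence of a support map at every \<open>x \<noteq> 0\<close> is the Hahn--Banach theorem, so smoothness
  asks for uniqueness only.\<close>

definition smooth_space :: "'a::complex_normed_vector itself \<Rightarrow> bool" where
  "smooth_space T \<longleftrightarrow> (\<forall>x::'a. x \<noteq> 0 \<longrightarrow> (\<exists>\<^sub>\<le>\<^sub>1 F. is_support_map x F))"

definition support_map :: "'a::complex_normed_vector \<Rightarrow> 'a \<Rightarrow> complex" where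
  "support_map x = (THE F. is_support_map x F)"

section \<open>The space \<open>L\<^sup>1(\<mu>, X)\<close>\<close>

text \<open>The library's Bochner integrability predicate is restricted to second countable value
  spaces, so \<open>L\<^sup>1\<close> is defined directly. Elements are represented by functions, with the
  seminorm \<open>L1_norm\<close>. Pointwise (rather than almost everywhere) convergence of the simple
  functions loses nothing: an almost everywhere limit of simple functions agrees almost
  everywhere with a pointwise one.\<close>

definition strongly_measurable :: "'s measure \<Rightarrow> ('s \<Rightarrow> 'a::real_normed_vector) \<Rightarrow> bool" where
  "strongly_measurable M f \<longleftrightarrow>
     (\<exists>u :: nat \<Rightarrow> 's \<Rightarrow> 'a. (\<forall>n. simple_function M (u n)) \<and>
        (\<forall>s\<in>space M. (\<lambda>n. u n s) \<longlonglongrightarrow> f s))"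

definition L1_space :: "'s measure \<Rightarrow> ('s \<Rightarrow> 'a::real_normed_vector) set" where
  "L1_space M = {f. strongly_measurable M f \<and> (\<integral>\<^sup>+ s. ennreal (norm (f s)) \<partial>M) < \<infinity>}"

definition L1_norm :: "'s measure \<Rightarrow> ('s \<Rightarrow> 'a::real_normed_vector) \<Rightarrow> real" where
  "L1_norm M f = (LINT s|M. norm (f s))"

text \<open>Subspaces of \<open>L\<^sup>1(\<mu>, X)\<close> are the images, modulo almost everywhere equality, of the
  following linear sets of representatives.\<close>

definition L1_subspace :: "'s measure \<Rightarrow> ('s \<Rightarrow> 'a::complex_normed_vector) set \<Rightarrow> bool" where
  "L1_subspace M G \<longleftrightarrow>
     G \<subseteq> L1_space M \<and> (\<lambda>s. 0) \<in> G \<and>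
     (\<forall>g\<in>G. \<forall>h\<in>G. (\<lambda>s. g s + h s) \<in> G) \<and>
     (\<forall>c. \<forall>g\<in>G. (\<lambda>s. c *\<^sub>C g s) \<in> G)"

definition L1_closure :: "'s measure \<Rightarrow> ('s \<Rightarrow> 'a::real_normed_vector) set \<Rightarrow> ('s \<Rightarrow> 'a) set" where
  "L1_closure M G = {f \<in> L1_space M. \<forall>e>0. \<exists>g\<in>G. L1_norm M (\<lambda>s. f s - g s) < e}"

definition best_approximants ::
  "'s measure \<Rightarrow> ('s \<Rightarrow> 'a::real_normed_vector) set \<Rightarrow> ('s \<Rightarrow> 'a) \<Rightarrow> ('s \<Rightarrow> 'a) set" where
  "best_approximants M G f =
     {g\<^sub>0 \<in> G. L1_norm M (\<lambda>s. f s - g\<^sub>0 s) = (INF g\<in>G. L1_norm M (\<lambda>s. f s - g s))}"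

definition zero_set :: "'s measure \<Rightarrow> ('s \<Rightarrow> 'a::zero) \<Rightarrow> 's set" where
  "zero_set M h = {s \<in> space M. h s = 0}"

end

theory Submission
  imports Defs
begin

text \<open>
  For \<open>X\<close> smooth, \<open>Re (F\<^sub>x y)\<close> is the one-sided derivative \<open>D x y\<close> of the norm at \<open>x\<close> in direction
  \<open>y\<close>: by Hahn--Banach, \<open>D x\<close> dominates a real linear functional that agrees with it at a given \<open>y\<close>,
  and the complexification of that functional is a support map at \<open>x\<close>. Also \<open>D 0 y = \<parallel>y\<parallel>\<close>, so
  with \<open>h = f - g\<^sub>0\<close> the integral \<open>\<integral> D (h s) (k s)\<close> is the sum of the two integrals of the
  criterion. By dominated convergence it is the derivative of the convex function \<open>t \<mapsto> \<parallel>h + t k\<parallel>\<^sub>1\<close>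
  at \<open>0+\<close>, hence \<open>g\<^sub>0\<close> is a best approximant iff it is nonnegative for all \<open>k \<in> G\<close>;
  replacing \<open>k\<close> by \<open>-k\<close> produces the absolute value.
\<close>

section \<open>Sublinear functionals and the Hahn--Banach theorem\<close>

definition sublinear :: "('a::real_vector \<Rightarrow> real) \<Rightarrow> bool" where
  "sublinear p \<longleftrightarrow> (\<forall>x y. p (x + y) \<le> p x + p y) \<and> (\<forall>c\<ge>0. \<forall>x. p (c *\<^sub>R x) = c * p x)"

text \<open>One inequality suffices for positive homogeneity: applied to \<open>inverse c\<close>
  and \<open>c *\<^sub>R x\<close>, it yields the reverse one.\<close>

lemma sublinearI:
  assumes add: "\<And>x y. p (x + y) \<le> p x + p y"
    and zero: "p 0 = 0"
    and scale: "\<And>c x. c > 0 \<Longrightarrow> p (c *\<^sub>R x) \<le> c * p x"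
  shows "sublinear p"
proof -
  have "p (c *\<^sub>R x) = c * p x" if "c \<ge> 0" for c x
  proof (cases "c = 0")
    case False
    with that have c: "c > 0" by simp
    have "p x \<le> inverse c * p (c *\<^sub>R x)"
      using scale[of "inverse c" "c *\<^sub>R x"] c by simp
    then have "c * p x \<le> p (c *\<^sub>R x)"
      using c by (simp add: field_simps)
    with scale[OF c, of x] show ?thesis by simp
  qed (simp add: zero)
  with add show ?thesis by (simp add: sublinear_def)
qed

lemma sublinear_add: "sublinear p \<Longrightarrow> p (x + y) \<le> p x + p y"
  by (simp add: sublinear_def)

lemma sublinear_scale: "sublinear p \<Longrightarrow> c \<ge> 0 \<Longrightarrow> p (c *\<^sub>R x) = c * p x"
  by (simp add: sublinear_def)

lemma sublinear_zero: "sublinear p \<Longrightarrow> p 0 = 0"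
  using sublinear_scale[of p 0 0] by simp

lemma sublinear_minus: "sublinear p \<Longrightarrow> - p (- x) \<le> p x"
  using sublinear_add[of p x "- x"] sublinear_zero[of p] by simp

text \<open>If \<open>q\<close> is minimal among sublinear functionals, then it equals its tilt, which forces
  \<open>q (- y) = - q y\<close>. Starting Zorn's lemma below the tilt of \<open>p\<close> at \<open>y\<close> pins the value at \<open>y\<close> to \<open>p y\<close>.\<close>

definition sublinear_tilt :: "('a::real_vector \<Rightarrow> real) \<Rightarrow> 'a \<Rightarrow> 'a \<Rightarrow> real" where
  "sublinear_tilt q y z = (INF t\<in>{0..}. q (z + t *\<^sub>R y) - t * q y)"

text \<open>The tilt is the largest sublinear \<open>r \<le> q\<close> with
  \<open>r (- y) \<le> - q y\<close>, since any such \<open>r\<close> satisfies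
  \<open>r z \<le> r (z + t *\<^sub>R y) + t * r (- y)\<close> for all
  \<open>t \<ge> 0\<close>.\<close>

lemma
  assumes q: "sublinear q"
  shows sublinear_tilt: "sublinear (sublinear_tilt q y)"
    and sublinear_tilt_le: "sublinear_tilt q y z \<le> q z"
    and sublinear_tilt_minus: "sublinear_tilt q y (- y) \<le> - q y"
proof -
  \<comment> \<open>A lower bound free of \<open>t\<close>, so that the infimum is a genuine one; it
    comes from writing \<open>t *\<^sub>R y\<close> as the sum of \<open>- z\<close> and
    \<open>z + t *\<^sub>R y\<close>.\<close>
  have "- q (- z) \<le> q (z + t *\<^sub>R y) - t * q y" if "t \<ge> 0" for z t
    using sublinear_add[OF q, of "- z" "z + t *\<^sub>R y"] sublinear_scale[OF q that] by simp
  then have bdd: "bdd_below ((\<lambda>t. q (z + t *\<^sub>R y) - t * q y) ` {0..})" for z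
    by (intro bdd_belowI2[where m = "- q (- z)"]) simp
  have le: "sublinear_tilt q y z \<le> q (z + t *\<^sub>R y) - t * q y" if "t \<ge> 0" for z t
    unfolding sublinear_tilt_def by (rule cINF_lower[OF bdd]) (use that in simp)
  have ge: "b \<le> sublinear_tilt q y z" if "\<And>t. t \<ge> 0 \<Longrightarrow> b \<le> q (z + t *\<^sub>R y) - t * q y" for b z
    unfolding sublinear_tilt_def by (rule cINF_greatest) (use that in auto)
  show "sublinear_tilt q y z \<le> q z" using le[of 0 z] by simp
  show "sublinear_tilt q y (- y) \<le> - q y"
    using le[of 1 "- y"] by (simp add: sublinear_zero[OF q])
  show "sublinear (sublinear_tilt q y)"
  proof (rule sublinearI)
    fix z w
    \<comment> \<open>Parameters \<open>t\<close> for \<open>z\<close> and \<open>s\<close> for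
      \<open>w\<close> combine to \<open>t + s\<close> for \<open>z + w\<close>. The infimum is
      taken over \<open>t\<close> with \<open>s\<close> fixed, and then over
      \<open>s\<close>.\<close>
    have "sublinear_tilt q y (z + w) - (q (w + s *\<^sub>R y) - s * q y) \<le> sublinear_tilt q y z"
      if s: "s \<ge> 0" for s
    proof (rule ge)
      fix t :: real assume t: "t \<ge> 0"
      have "q ((z + w) + (t + s) *\<^sub>R y) \<le> q (z + t *\<^sub>R y) + q (w + s *\<^sub>R y)"
        using sublinear_add[OF q, of "z + t *\<^sub>R y" "w + s *\<^sub>R y"] by (simp add: algebra_simps)
      with le[of "t + s" "z + w"] s t
      show "sublinear_tilt q y (z + w) - (q (w + s *\<^sub>R y) - s * q y) \<le> q (z + t *\<^sub>R y) - t * q y"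
        by (simp add: algebra_simps)
    qed
    then have "sublinear_tilt q y (z + w) - sublinear_tilt q y z \<le> sublinear_tilt q y w"
      by (intro ge) (simp add: algebra_simps)
    then show "sublinear_tilt q y (z + w) \<le> sublinear_tilt q y z + sublinear_tilt q y w"
      by simp
  next
    have "0 \<le> sublinear_tilt q y 0" by (rule ge) (simp add: sublinear_scale[OF q])
    with le[of 0 0] show "sublinear_tilt q y 0 = 0" by (simp add: sublinear_zero[OF q])
  next
    fix c :: real and z assume c: "c > 0"
    have "inverse c * sublinear_tilt q y (c *\<^sub>R z) \<le> sublinear_tilt q y z"
    proof (rule ge)
      fix t :: real assume t: "t \<ge> 0"
      have "q (c *\<^sub>R z + (c * t) *\<^sub>R y) = c * q (z + t *\<^sub>R y)"
        using sublinear_scale[OF q, of c "z + t *\<^sub>R y"] c by (simp add: algebra_simps)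
      with le[of "c * t" "c *\<^sub>R z"] c t
      show "inverse c * sublinear_tilt q y (c *\<^sub>R z) \<le> q (z + t *\<^sub>R y) - t * q y"
        by (simp add: field_simps)
    qed
    with c show "sublinear_tilt q y (c *\<^sub>R z) \<le> c * sublinear_tilt q y z"
      by (simp add: field_simps)
  qed
qed

text \<open>Provides the lower bounds for Zorn's lemma. Subadditivity survives the infimum because
  two members \<open>q\<close> and \<open>r\<close> of a chain can both be replaced by the smaller
  one.\<close>

lemma sublinear_chain_INF:
  assumes C: "C \<noteq> {}" "\<And>q. q \<in> C \<Longrightarrow> sublinear q \<and> q \<le> p"
    and chain: "\<And>q r. q \<in> C \<Longrightarrow> r \<in> C \<Longrightarrow> q \<le> r \<or> r \<le> q"
  shows "sublinear (\<lambda>z. INF q\<in>C. q z)" and "\<And>q. q \<in> C \<Longrightarrow> (\<lambda>z. INF q\<in>C. q z) \<le> q"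
proof -
  have "- p (- z) \<le> q z" if "q \<in> C" for q z
    using C(2)[OF that] sublinear_minus[of q z] by (auto simp: le_fun_def intro: order_trans[rotated])
  then have bdd: "bdd_below ((\<lambda>q. q z) ` C)" for z
    by (rule bdd_belowI2)
  have le: "(INF q\<in>C. q z) \<le> q z" if "q \<in> C" for q z
    by (rule cINF_lower[OF bdd that])
  have ge: "b \<le> (INF q\<in>C. q z)" if "\<And>q. q \<in> C \<Longrightarrow> b \<le> q z" for b z
    by (rule cINF_greatest[OF C(1) that])
  show "(\<lambda>z. INF q\<in>C. q z) \<le> q" if "q \<in> C" for q
    using le[OF that] by (simp add: le_fun_def)
  show "sublinear (\<lambda>z. INF q\<in>C. q z)"
  proof (rule sublinearI)
    fix z w
    have *: "(INF q\<in>C. q (z + w)) \<le> q z + r w" if qr: "q \<in> C" "r \<in> C" for q r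
    proof -
      obtain m where m: "m \<in> C" "m \<le> q" "m \<le> r"
        using chain[OF qr] qr by blast
      have "(INF q\<in>C. q (z + w)) \<le> m (z + w)" by (rule le[OF m(1)])
      also have "\<dots> \<le> m z + m w" using C(2)[OF m(1)] by (simp add: sublinear_add)
      also have "\<dots> \<le> q z + r w" using m by (intro add_mono) (auto simp: le_fun_def)
      finally show ?thesis .
    qed
    have "(INF q\<in>C. q (z + w)) - r w \<le> (INF q\<in>C. q z)" if "r \<in> C" for r
      by (rule ge) (use *[OF _ that] in \<open>simp add: algebra_simps\<close>)
    then have "(INF q\<in>C. q (z + w)) - (INF q\<in>C. q z) \<le> (INF q\<in>C. q w)"
      by (intro ge) (simp add: algebra_simps)
    then show "(INF q\<in>C. q (z + w)) \<le> (INF q\<in>C. q z) + (INF q\<in>C. q w)" by simp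
  next
    show "(INF q\<in>C. q 0) = 0"
      using C by (simp add: sublinear_zero cong: INF_cong)
  next
    fix c :: real and z assume c: "c > 0"
    have "inverse c * (INF q\<in>C. q (c *\<^sub>R z)) \<le> (INF q\<in>C. q z)"
    proof (rule ge)
      fix q assume q: "q \<in> C"
      from le[OF q, of "c *\<^sub>R z"] C(2)[OF q] c
      show "inverse c * (INF q\<in>C. q (c *\<^sub>R z)) \<le> q z"
        by (simp add: sublinear_scale field_simps)
    qed
    with c show "(INF q\<in>C. q (c *\<^sub>R z)) \<le> c * (INF q\<in>C. q z)"
      by (simp add: field_simps)
  qed
qed

text \<open>Zorn's lemma for the reversed order, with \<open>p\<close> itself bounding the empty
  chain. Minimality below \<open>p\<close> is minimality among all sublinear functionals, since
  \<open>q \<le> m\<close> already forces \<open>q \<le> p\<close>.\<close>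

lemma minimal_sublinear_exists:
  assumes p: "sublinear p"
  obtains m where "sublinear m" "m \<le> p" "\<And>q. sublinear q \<Longrightarrow> q \<le> m \<Longrightarrow> q = m"
proof -
  let ?A = "{q. sublinear q \<and> q \<le> p}"
  have "\<exists>m\<in>?A. \<forall>q\<in>?A. m \<ge> q \<longrightarrow> q = m"
  proof (rule predicate_Zorn)
    show "partial_order_on ?A (relation_of (\<ge>) ?A)"
      by (rule partial_order_on_relation_ofI) auto
  next
    fix C assume C: "C \<in> Chains (relation_of (\<ge>) ?A)"
    show "\<exists>u\<in>?A. \<forall>q\<in>C. q \<ge> u"
    proof (cases "C = {}")
      case True
      with p show ?thesis by auto
    next
      case False
      have sub: "sublinear q \<and> q \<le> p" if "q \<in> C" for q
        using Chains_relation_of[OF C] that by blast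
      have chain: "q \<le> r \<or> r \<le> q" if "q \<in> C" "r \<in> C" for q r
        using C that by (auto simp: Chains_def relation_of_def)
      note INF = sublinear_chain_INF[OF False sub chain]
      from False obtain q where "q \<in> C" by blast
      with INF(2) sub have "(\<lambda>z. INF q\<in>C. q z) \<le> p" by (meson order_trans)
      with INF show ?thesis by (intro bexI[of _ "\<lambda>z. INF q\<in>C. q z"]) auto
    qed
  qed
  then obtain m where "sublinear m" "m \<le> p" "\<And>q. sublinear q \<Longrightarrow> q \<le> p \<Longrightarrow> q \<le> m \<Longrightarrow> q = m"
    by blast
  with that show ?thesis by (meson order_trans)
qed

theorem hahn_banach_sublinear:
  fixes p :: "'a::real_vector \<Rightarrow> real"
  assumes p: "sublinear p"
  obtains L where "linear L" "L \<le> p" "L y = p y"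
proof -
  obtain L where L: "sublinear L" "L \<le> sublinear_tilt p y"
    and min: "\<And>q. sublinear q \<Longrightarrow> q \<le> L \<Longrightarrow> q = L"
    using minimal_sublinear_exists[OF sublinear_tilt[OF p]] by blast
  have odd: "L (- x) = - L x" for x
  proof -
    have "sublinear_tilt L x = L"
      using sublinear_tilt[OF L(1)] sublinear_tilt_le[OF L(1)] by (intro min) (auto simp: le_fun_def)
    with sublinear_tilt_minus[OF L(1), of x] have "L (- x) \<le> - L x" by simp
    with sublinear_minus[OF L(1), of x] show ?thesis by simp
  qed
  have "linear L"
  proof (rule linearI)
    fix x z
    \<comment> \<open>By oddness, subadditivity at \<open>- x\<close> and \<open>- z\<close> is
      superadditivity at \<open>x\<close> and \<open>z\<close>.\<close>
    from sublinear_add[OF L(1), of x z] sublinear_add[OF L(1), of "- x" "- z"] odd[of "x + z"]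
    show "L (x + z) = L x + L z" by (simp add: odd)
  next
    fix c :: real and x
    show "L (c *\<^sub>R x) = c *\<^sub>R L x"
      using sublinear_scale[OF L(1), of c x] sublinear_scale[OF L(1), of "- c" x] odd[of "c *\<^sub>R x"]
      by (cases "c \<ge> 0") auto
  qed
  moreover have le: "L \<le> p"
    using L(2) sublinear_tilt_le[OF p] by (auto simp: le_fun_def intro: order_trans)
  moreover have "L y = p y"
  proof (rule antisym)
    show "L y \<le> p y" using le by (simp add: le_fun_def)
    \<comment> \<open>Here it matters that \<open>L\<close> lies below the tilt and not merely below
      \<open>p\<close>.\<close>
    have "L (- y) \<le> - p y"
      using L(2) sublinear_tilt_minus[OF p, of y] by (auto simp: le_fun_def intro: order_trans)
    then show "p y \<le> L y" by (simp add: odd)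
  qed
  ultimately show ?thesis by (rule that)
qed

section \<open>The directional derivative of the norm\<close>

definition norm_quotient :: "'a::real_normed_vector \<Rightarrow> 'a \<Rightarrow> real \<Rightarrow> real" where
  "norm_quotient x y t = (norm (x + t *\<^sub>R y) - norm x) / t"

text \<open>The right derivative at \<open>0\<close> of
  \<open>t \<mapsto> norm (x + t *\<^sub>R y)\<close>. The quotients decrease as \<open>t\<close>
  decreases to \<open>0\<close>, so their limit is an infimum.\<close>

definition norm_deriv :: "'a::real_normed_vector \<Rightarrow> 'a \<Rightarrow> real" where
  "norm_deriv x y = (INF t\<in>{0<..}. norm_quotient x y t)"

lemma abs_norm_quotient_le: "t > 0 \<Longrightarrow> \<bar>norm_quotient x y t\<bar> \<le> norm y"
  using norm_triangle_ineq3[of "x + t *\<^sub>R y" x]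
  by (simp add: norm_quotient_def field_simps)

text \<open>Convexity of the norm: \<open>x + s *\<^sub>R y\<close> is the convex combination of
  \<open>x\<close> and \<open>x + t *\<^sub>R y\<close> with weights \<open>(t - s) / t\<close> and
  \<open>s / t\<close>.\<close>

lemma norm_quotient_mono:
  assumes "0 < s" "s \<le> t"
  shows "norm_quotient x y s \<le> norm_quotient x y t"
proof -
  have "t *\<^sub>R (x + s *\<^sub>R y) = (t - s) *\<^sub>R x + s *\<^sub>R (x + t *\<^sub>R y)"
    by (simp add: algebra_simps)
  then have "t * norm (x + s *\<^sub>R y) = norm ((t - s) *\<^sub>R x + s *\<^sub>R (x + t *\<^sub>R y))"
    using assms by (metis abs_of_pos norm_scaleR order.strict_trans2)
  also have "\<dots> \<le> (t - s) * norm x + s * norm (x + t *\<^sub>R y)"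
    using assms by (intro norm_triangle_le) simp
  finally have "t * (norm (x + s *\<^sub>R y) - norm x) \<le> s * (norm (x + t *\<^sub>R y) - norm x)"
    by (simp add: algebra_simps)
  with assms show ?thesis by (simp add: norm_quotient_def field_simps)
qed

lemma norm_quotient_tendsto: "(norm_quotient x y \<longlongrightarrow> norm_deriv x y) (at_right 0)"
proof -
  have "- norm y \<le> norm_quotient x y t" if "t > 0" for t
    using abs_norm_quotient_le[OF that, of x y] by simp
  then have "(norm_quotient x y \<longlongrightarrow> Inf (norm_quotient x y ` ({0<..} \<inter> UNIV)))
      (at 0 within ({0<..} \<inter> UNIV))"
    by (intro Lim_right_bound norm_quotient_mono)
  then show ?thesis by (simp add: norm_deriv_def)
qed

lemma norm_deriv_le_quotient:
  assumes "t > 0"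
  shows "norm_deriv x y \<le> norm_quotient x y t"
proof -
  have "- norm y \<le> norm_quotient x y t" if "t > 0" for t
    using abs_norm_quotient_le[OF that, of x y] by simp
  then have "bdd_below (norm_quotient x y ` {0<..})" by (intro bdd_belowI2) auto
  with assms show ?thesis unfolding norm_deriv_def by (intro cINF_lower) auto
qed

lemma norm_deriv_le_diff: "norm_deriv x y \<le> norm (x + y) - norm x"
  using norm_deriv_le_quotient[of 1 x y] by (simp add: norm_quotient_def)

lemma norm_deriv_le_norm: "norm_deriv x y \<le> norm y"
  using norm_deriv_le_diff[of x y] norm_triangle_ineq[of x y] by simp

lemma norm_deriv_zero_left: "norm_deriv 0 y = norm y"
  by (simp add: norm_deriv_def norm_quotient_def cong: image_cong_simp)

lemma norm_deriv_self_minus: "norm_deriv x (- x) \<le> - norm x"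
  using norm_deriv_le_diff[of x "- x"] by simp

lemma sublinear_norm_deriv: "sublinear (norm_deriv x)"
proof (rule sublinearI)
  show "norm_deriv x 0 = 0"
    by (simp add: norm_deriv_def norm_quotient_def cong: INF_cong)
next
  \<comment> \<open>Used with \<open>c = 2\<close> for subadditivity and with the scaling factor for
    homogeneity.\<close>
  have scale_tendsto: "((\<lambda>t. norm_quotient x y (c * t)) \<longlongrightarrow> norm_deriv x y) (at_right 0)"
    if "c > 0" for c and y :: 'a
  proof -
    have "(norm_quotient x y \<longlongrightarrow> norm_deriv x y) (filtermap ((*) c) (at_right 0))"
      using norm_quotient_tendsto[of x y] filtermap_times_pos_at_right[OF that, of 0] by simp
    then show ?thesis by (simp only: filterlim_filtermap)
  qed
  {
    fix y z
    have "((\<lambda>t. norm_quotient x y (2 * t) + norm_quotient x z (2 * t)) \<longlongrightarrow> norm_deriv x y + norm_deriv x z) (at_right 0)"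
      by (intro tendsto_add scale_tendsto) auto
    moreover have "\<forall>\<^sub>F t in at_right 0. norm_quotient x (y + z) t \<le> norm_quotient x y (2 * t) + norm_quotient x z (2 * t)"
    proof (rule eventually_mono[OF eventually_at_right_less])
      fix t :: real assume t: "0 < t"
      \<comment> \<open>The point on the left is the midpoint of two points reached with step
        \<open>2 * t\<close>, which is why the quotients are compared at different steps.\<close>
      have "2 *\<^sub>R (x + t *\<^sub>R (y + z)) = (x + (2 * t) *\<^sub>R y) + (x + (2 * t) *\<^sub>R z)"
        by (simp add: algebra_simps scaleR_2)
      then have "2 * norm (x + t *\<^sub>R (y + z)) = norm ((x + (2 * t) *\<^sub>R y) + (x + (2 * t) *\<^sub>R z))"
        by (metis abs_numeral norm_scaleR)
      also have "\<dots> \<le> norm (x + (2 * t) *\<^sub>R y) + norm (x + (2 * t) *\<^sub>R z)"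
        by (rule norm_triangle_ineq)
      finally have "(2 * norm (x + t *\<^sub>R (y + z)) - 2 * norm x) / (2 * t) \<le>
          ((norm (x + (2 * t) *\<^sub>R y) - norm x) + (norm (x + (2 * t) *\<^sub>R z) - norm x)) / (2 * t)"
        using t by (intro divide_right_mono) auto
      moreover have "(2 * norm (x + t *\<^sub>R (y + z)) - 2 * norm x) / (2 * t) =
          (norm (x + t *\<^sub>R (y + z)) - norm x) / t"
        using t by (simp add: field_simps)
      ultimately show "norm_quotient x (y + z) t \<le> norm_quotient x y (2 * t) + norm_quotient x z (2 * t)"
        by (simp only: norm_quotient_def add_divide_distrib)
    qed
    ultimately show "norm_deriv x (y + z) \<le> norm_deriv x y + norm_deriv x z"
      by (rule tendsto_le[OF trivial_limit_at_right_real _ norm_quotient_tendsto])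
  next
    fix c :: real and y assume c: "c > 0"
    have "((\<lambda>t. c * norm_quotient x y (c * t)) \<longlongrightarrow> c * norm_deriv x y) (at_right 0)"
      by (intro tendsto_mult_left scale_tendsto c)
    moreover have "norm_quotient x (c *\<^sub>R y) = (\<lambda>t. c * norm_quotient x y (c * t))"
      using c by (simp add: norm_quotient_def mult.commute fun_eq_iff)
    ultimately have "norm_deriv x (c *\<^sub>R y) = c * norm_deriv x y"
      using norm_quotient_tendsto[of x "c *\<^sub>R y"]
      by (metis tendsto_unique trivial_limit_at_right_real)
    then show "norm_deriv x (c *\<^sub>R y) \<le> c * norm_deriv x y" by simp
  }
qed

section \<open>Support maps as derivatives of the norm\<close>

lemma scaleC_scaleR_commute: "c *\<^sub>C (r *\<^sub>R x) = r *\<^sub>R (c *\<^sub>C (x::'a::complex_normed_vector))"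
  by (metis mult.commute scaleC_of_real scaleC_scaleC)

lemma scaleC_minus_one: "(-1) *\<^sub>C x = - (x::'a::complex_normed_vector)"
  using scaleC_of_real[of "-1" x] by simp

text \<open>Multiplying \<open>y\<close> by a scalar of modulus one makes the value of
  \<open>F\<close> real and nonnegative, so the bound on real parts applies.\<close>

lemma complex_functional_bound:
  fixes F :: "'a::complex_normed_vector \<Rightarrow> complex"
  assumes "\<And>c y. F (c *\<^sub>C y) = c * F y" and "\<And>y. Re (F y) \<le> norm y"
  shows "norm (F y) \<le> norm y"
proof (cases "F y = 0")
  case False
  define c where "c = complex_of_real (cmod (F y)) / F y"
  have "c * F y = complex_of_real (cmod (F y))"
    using False by (simp add: c_def)
  then have "cmod (F y) = Re (F (c *\<^sub>C y))" by (simp add: assms(1))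
  also have "\<dots> \<le> norm (c *\<^sub>C y)" by (rule assms(2))
  also have "\<dots> = norm y" using False by (simp add: norm_scaleC c_def norm_divide)
  finally show ?thesis .
qed simp

lemma support_map_exists:
  fixes x :: "'a::complex_normed_vector"
  assumes x: "x \<noteq> 0"
  obtains F where "is_support_map x F" "Re (F y) = norm_deriv x y"
proof -
  obtain L where L: "linear L" "L \<le> norm_deriv x" and Ly: "L y = norm_deriv x y"
    using hahn_banach_sublinear[OF sublinear_norm_deriv] by blast
  note L_simps = linear_add[OF L(1)] linear_scale[OF L(1)]
  have L_norm: "L z \<le> norm z" for z
    using L(2) norm_deriv_le_norm[of x z] by (auto simp: le_fun_def intro: order_trans)
  \<comment> \<open>Domination in the direction \<open>- x\<close> gives
    \<open>L x \<ge> norm x\<close>, so \<open>L\<close> attains its norm at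
    \<open>x\<close>.\<close>
  have "L (- x) \<le> - norm x"
    using L(2) norm_deriv_self_minus[of x] by (auto simp: le_fun_def intro: order_trans)
  then have Lx: "L x = norm x"
    using L_norm[of x] by (simp add: linear_neg[OF L(1)])
  \<comment> \<open>The only complex linear functional with real part \<open>L\<close>: complex
    linearity forces its imaginary part at \<open>z\<close> to be
    \<open>- L (\<i> *\<^sub>C z)\<close>.\<close>
  define F where "F z = Complex (L z) (- L (\<i> *\<^sub>C z))" for z
  have Re_F: "Re (F z) = L z" for z by (simp add: F_def)
  have F_add: "F (z + w) = F z + F w" for z w
    by (simp add: F_def L_simps scaleC_add_right complex_eq_iff)
  have F_scaleR: "F (r *\<^sub>R z) = r *\<^sub>R F z" for r z
    by (simp add: F_def L_simps scaleC_scaleR_commute complex_eq_iff)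
  have F_i: "F (\<i> *\<^sub>C z) = \<i> * F z" for z
    by (simp add: F_def complex_eq_iff scaleC_scaleC scaleC_minus_one linear_neg[OF L(1)])
  have F_scaleC: "F (c *\<^sub>C z) = c * F z" for c z
  proof -
    have "c = complex_of_real (Re c) + complex_of_real (Im c) * \<i>"
      by (simp add: complex_eq_iff)
    then have "c *\<^sub>C z = (complex_of_real (Re c) + complex_of_real (Im c) * \<i>) *\<^sub>C z"
      by (rule arg_cong)
    also have "\<dots> = Re c *\<^sub>R z + Im c *\<^sub>R (\<i> *\<^sub>C z)"
      by (simp only: scaleC_add_left scaleC_of_real flip: scaleC_scaleC)
    finally have "F (c *\<^sub>C z) = F (Re c *\<^sub>R z + Im c *\<^sub>R (\<i> *\<^sub>C z))"
      by (rule arg_cong)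
    then have "F (c *\<^sub>C z) = (complex_of_real (Re c) + \<i> * complex_of_real (Im c)) * F z"
      by (simp add: F_add F_scaleR F_i scaleR_conv_of_real algebra_simps)
    then show ?thesis by (simp flip: complex_eq)
  qed
  have F_norm: "norm (F z) \<le> norm z" for z
    by (rule complex_functional_bound) (simp_all add: F_scaleC Re_F L_norm)
  have Fx: "F x = complex_of_real (norm x)"
  proof -
    \<comment> \<open>The real part of \<open>F x\<close> already has the full modulus
      \<open>norm x\<close>, leaving no room for an imaginary part.\<close>
    have "(cmod (F x))\<^sup>2 \<le> (norm x)\<^sup>2" by (intro power_mono F_norm) simp
    then have "Im (F x) = 0" using Lx by (simp add: cmod_power2 Re_F)
    with Lx show ?thesis by (simp add: complex_eq_iff Re_F)
  qed
  have bl: "bounded_linear F"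
    by (rule bounded_linear_intro[where K = 1]) (simp_all add: F_add F_scaleR F_norm)
  have "onorm F = 1"
  proof (rule antisym)
    show "onorm F \<le> 1" by (rule onorm_bound) (simp_all add: F_norm)
    show "1 \<le> onorm F" using onorm[OF bl, of x] x by (simp add: Fx)
  qed
  with bl F_scaleC Fx have "is_support_map x F" by (simp add: is_support_map_def)
  then show ?thesis by (rule that) (simp add: Re_F Ly)
qed

text \<open>The support map supplied by Hahn--Banach may depend on \<open>y\<close>; uniqueness
  identifies it with \<open>support_map x\<close> for every \<open>y\<close>.\<close>

lemma Re_support_map:
  assumes "smooth_space TYPE('a::complex_normed_vector)" and x: "(x::'a) \<noteq> 0"
  shows "Re (support_map x y) = norm_deriv x y"
proof -
  obtain F where F: "is_support_map x F" "Re (F y) = norm_deriv x y"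
    using support_map_exists[OF x] .
  have "support_map x = F"
    unfolding support_map_def
    by (rule the1_equality') (use assms F in \<open>auto simp: smooth_space_def\<close>)
  with F show ?thesis by simp
qed

text \<open>Smoothness makes the one-sided derivative two-sided: the support maps realizing it at
  \<open>y\<close> and at \<open>- y\<close> coincide, and they are linear.\<close>

lemma norm_deriv_minus:
  assumes "smooth_space TYPE('a::complex_normed_vector)" and x: "(x::'a) \<noteq> 0"
  shows "norm_deriv x (- y) = - norm_deriv x y"
proof -
  obtain F where F: "is_support_map x F" "Re (F y) = norm_deriv x y"
    using support_map_exists[OF x] .
  obtain F' where F': "is_support_map x F'" "Re (F' (- y)) = norm_deriv x (- y)"
    using support_map_exists[OF x] .
  have "F' = F"
    using assms F F' by (auto simp: smooth_space_def Uniq_def)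
  moreover have "F (- y) = - F y"
    using F(1) by (auto simp: is_support_map_def intro: linear_neg bounded_linear.linear)
  ultimately show ?thesis using F F' by simp
qed

section \<open>Variations of the \<open>L\<^sup>1\<close> norm\<close>

lemma strongly_measurable_norm:
  assumes "strongly_measurable M f"
  shows "(\<lambda>s. norm (f s)) \<in> borel_measurable M"
proof -
  obtain u where u: "\<And>n. simple_function M (u n)" "\<And>s. s \<in> space M \<Longrightarrow> (\<lambda>n. u n s) \<longlonglongrightarrow> f s"
    using assms by (auto simp: strongly_measurable_def)
  show ?thesis
  proof (rule borel_measurable_LIMSEQ_real)
    show "(\<lambda>n. norm (u n s)) \<longlonglongrightarrow> norm (f s)" if "s \<in> space M" for s
      by (intro tendsto_norm u that)
    show "(\<lambda>s. norm (u n s)) \<in> borel_measurable M" for n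
      by (rule borel_measurable_simple_function[OF simple_function_compose1[OF u(1)]])
  qed
qed

lemma strongly_measurable_add_scaleR:
  assumes "strongly_measurable M f" "strongly_measurable M g"
  shows "strongly_measurable M (\<lambda>s. f s + c *\<^sub>R g s)"
proof -
  obtain u where u: "\<And>n. simple_function M (u n)" "\<And>s. s \<in> space M \<Longrightarrow> (\<lambda>n. u n s) \<longlonglongrightarrow> f s"
    using assms(1) by (auto simp: strongly_measurable_def)
  obtain v where v: "\<And>n. simple_function M (v n)" "\<And>s. s \<in> space M \<Longrightarrow> (\<lambda>n. v n s) \<longlonglongrightarrow> g s"
    using assms(2) by (auto simp: strongly_measurable_def)
  show ?thesis
    unfolding strongly_measurable_def
  proof (intro exI conjI allI ballI)
    show "simple_function M (\<lambda>s. u n s + c *\<^sub>R v n s)" for n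
      by (rule simple_function_compose2[OF u(1) v(1)])
    show "(\<lambda>n. u n s + c *\<^sub>R v n s) \<longlonglongrightarrow> f s + c *\<^sub>R g s" if "s \<in> space M" for s
      by (intro tendsto_intros u v that)
  qed
qed

lemma integrable_norm_L1_space:
  assumes "f \<in> L1_space M"
  shows "integrable M (\<lambda>s. norm (f s))"
  using assms strongly_measurable_norm[of M f]
  by (simp add: L1_space_def integrable_iff_bounded)

lemma L1_space_add_scaleR:
  assumes f: "f \<in> L1_space M" and g: "g \<in> L1_space M"
  shows "(\<lambda>s. f s + c *\<^sub>R g s) \<in> L1_space M"
proof -
  have meas: "strongly_measurable M (\<lambda>s. f s + c *\<^sub>R g s)"
    using f g by (intro strongly_measurable_add_scaleR) (simp_all add: L1_space_def)
  have "integrable M (\<lambda>s. norm (f s + c *\<^sub>R g s))"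
  proof (rule Bochner_Integration.integrable_bound)
    show "integrable M (\<lambda>s. norm (f s) + \<bar>c\<bar> * norm (g s))"
      by (intro Bochner_Integration.integrable_add integrable_mult_right integrable_norm_L1_space f g)
    show "AE s in M. norm (norm (f s + c *\<^sub>R g s)) \<le> norm (norm (f s) + \<bar>c\<bar> * norm (g s))"
      by (intro AE_I2) (simp add: norm_triangle_le)
  qed (rule strongly_measurable_norm[OF meas])
  with meas show ?thesis by (simp add: L1_space_def integrable_iff_bounded)
qed

text \<open>Dominated convergence along the steps \<open>1 / (n + 1)\<close>; by the triangle
  inequality, \<open>norm (k s)\<close> dominates every quotient.\<close>

lemma
  assumes h: "h \<in> L1_space M" and k: "k \<in> L1_space M"
  shows integrable_norm_deriv: "integrable M (\<lambda>s. norm_deriv (h s) (k s))"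
    and L1_norm_quotient_tendsto:
      "(\<lambda>n. (L1_norm M (\<lambda>s. h s + inverse (Suc n) *\<^sub>R k s) - L1_norm M h) / inverse (Suc n))
        \<longlonglongrightarrow> (LINT s|M. norm_deriv (h s) (k s))"
proof -
  define q where "q n s = norm_quotient (h s) (k s) (inverse (Suc n))" for n s
  have int: "integrable M (\<lambda>s. norm (h s + inverse (Suc n) *\<^sub>R k s))" for n
    by (intro integrable_norm_L1_space L1_space_add_scaleR h k)
  have q_eq: "(LINT s|M. q n s) =
      (L1_norm M (\<lambda>s. h s + inverse (Suc n) *\<^sub>R k s) - L1_norm M h) / inverse (Suc n)" for n
    using Bochner_Integration.integral_diff[OF int[of n] integrable_norm_L1_space[OF h]]
    by (simp add: q_def norm_quotient_def L1_norm_def)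
  have q_meas: "q n \<in> borel_measurable M" for n
    using int[of n] integrable_norm_L1_space[OF h]
    unfolding q_def norm_quotient_def by measurable
  have "filterlim (\<lambda>n. inverse (real (Suc n))) (at_right 0) sequentially"
    using LIMSEQ_inverse_real_of_nat by (simp add: filterlim_at eventually_sequentially)
  then have q_lim: "(\<lambda>n. q n s) \<longlonglongrightarrow> norm_deriv (h s) (k s)" for s
    unfolding q_def by (rule filterlim_compose[OF norm_quotient_tendsto])
  \<comment> \<open>Measurability comes from the sequential limit, as the infimum defining
    \<open>norm_deriv\<close> runs over uncountably many steps.\<close>
  have deriv_meas: "(\<lambda>s. norm_deriv (h s) (k s)) \<in> borel_measurable M"
    by (rule borel_measurable_LIMSEQ_real[OF q_lim q_meas])
  note dc = deriv_meas q_meas integrable_norm_L1_space[OF k] AE_I2[OF q_lim]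
  have bound: "AE s in M. norm (q n s) \<le> norm (k s)" for n
    by (intro AE_I2) (simp add: q_def abs_norm_quotient_le)
  show "integrable M (\<lambda>s. norm_deriv (h s) (k s))"
    by (rule integrable_dominated_convergence[OF dc bound])
  show "(\<lambda>n. (L1_norm M (\<lambda>s. h s + inverse (Suc n) *\<^sub>R k s) - L1_norm M h) / inverse (Suc n))
      \<longlonglongrightarrow> (LINT s|M. norm_deriv (h s) (k s))"
    using integral_dominated_convergence[OF dc bound] by (simp only: q_eq)
qed

lemma L1_norm_deriv_le_diff:
  assumes h: "h \<in> L1_space M" and k: "k \<in> L1_space M"
  shows "(LINT s|M. norm_deriv (h s) (k s)) \<le> L1_norm M (\<lambda>s. h s + k s) - L1_norm M h"
proof -
  have int: "integrable M (\<lambda>s. norm (h s + k s))"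
    using integrable_norm_L1_space[OF L1_space_add_scaleR[OF h k, of 1]] by simp
  have "(LINT s|M. norm_deriv (h s) (k s)) \<le> (LINT s|M. norm (h s + k s) - norm (h s))"
    by (intro integral_mono integrable_norm_deriv Bochner_Integration.integrable_diff int integrable_norm_L1_space h k norm_deriv_le_diff)
  also have "\<dots> = L1_norm M (\<lambda>s. h s + k s) - L1_norm M h"
    by (simp add: L1_norm_def int integrable_norm_L1_space h)
  finally show ?thesis .
qed

section \<open>Best approximation as a variational inequality\<close>

lemma L1_subspace_add_scaleR:
  assumes G: "L1_subspace M G" and "g \<in> G" "k \<in> G"
  shows "(\<lambda>s. g s + c *\<^sub>R k s) \<in> G"
proof -
  have "(\<lambda>s. complex_of_real c *\<^sub>C k s) \<in> G"
    using assms by (simp add: L1_subspace_def)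
  with assms show ?thesis by (simp add: L1_subspace_def scaleC_of_real)
qed

text \<open>Nonnegativity of \<open>L1_norm\<close> bounds the infimum from below, so membership of
  \<open>g\<^sub>0\<close> in \<open>G\<close> leaves only one inequality to check.\<close>

lemma best_approximants_iff:
  assumes "g\<^sub>0 \<in> G"
  shows "g\<^sub>0 \<in> best_approximants M G f \<longleftrightarrow>
    (\<forall>g\<in>G. L1_norm M (\<lambda>s. f s - g\<^sub>0 s) \<le> L1_norm M (\<lambda>s. f s - g s))"
proof -
  have "0 \<le> L1_norm M h" for h :: "'a \<Rightarrow> 'b" by (simp add: L1_norm_def)
  then have bdd: "bdd_below ((\<lambda>g. L1_norm M (\<lambda>s. f s - g s)) ` G)"
    by (intro bdd_belowI2)
  have "(INF g\<in>G. L1_norm M (\<lambda>s. f s - g s)) \<le> L1_norm M (\<lambda>s. f s - g\<^sub>0 s)"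
    by (rule cINF_lower[OF bdd assms])
  then show ?thesis
    using le_cINF_iff[OF _ bdd, of "L1_norm M (\<lambda>s. f s - g\<^sub>0 s)"] assms
    by (auto simp: best_approximants_def)
qed

lemma best_approximants_iff_norm_deriv:
  assumes G: "L1_subspace M G" and f: "f \<in> L1_space M" and g\<^sub>0: "g\<^sub>0 \<in> G"
  shows "g\<^sub>0 \<in> best_approximants M G f \<longleftrightarrow>
    (\<forall>k\<in>G. 0 \<le> (LINT s|M. norm_deriv (f s - g\<^sub>0 s) (k s)))"
proof -
  define h where "h = (\<lambda>s. f s - g\<^sub>0 s)"
  have L1: "k \<in> L1_space M" if "k \<in> G" for k
    using G that by (auto simp: L1_subspace_def)
  have h: "h \<in> L1_space M"
    using L1_space_add_scaleR[OF f L1[OF g\<^sub>0], of "-1"] by (simp add: h_def)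
  have "(\<forall>g\<in>G. L1_norm M h \<le> L1_norm M (\<lambda>s. f s - g s)) \<longleftrightarrow>
    (\<forall>k\<in>G. 0 \<le> (LINT s|M. norm_deriv (h s) (k s)))"
  proof (intro iffI ballI)
    fix k assume best: "\<forall>g\<in>G. L1_norm M h \<le> L1_norm M (\<lambda>s. f s - g s)" and k: "k \<in> G"
    \<comment> \<open>The competitor is \<open>g\<^sub>0 - t k\<close>, whose error is
      \<open>h + t k\<close>; hence all difference quotients with positive step are
      nonnegative.\<close>
    have "L1_norm M h \<le> L1_norm M (\<lambda>s. h s + t *\<^sub>R k s)" for t
      using best[rule_format, OF L1_subspace_add_scaleR[OF G g\<^sub>0 k, of "- t"]]
      by (simp add: h_def algebra_simps)
    then show "0 \<le> (LINT s|M. norm_deriv (h s) (k s))"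
      by (intro LIMSEQ_le_const[OF L1_norm_quotient_tendsto[OF h L1[OF k]]])
        (auto intro!: exI[of _ 0] mult_nonneg_nonneg simp: divide_inverse)
  next
    fix g assume deriv: "\<forall>k\<in>G. 0 \<le> (LINT s|M. norm_deriv (h s) (k s))" and g: "g \<in> G"
    \<comment> \<open>The error \<open>f - g\<close> is \<open>h\<close> moved by this direction,
      and convexity bounds the increase of the norm below by the derivative.\<close>
    have k: "(\<lambda>s. g\<^sub>0 s - g s) \<in> G"
      using L1_subspace_add_scaleR[OF G g\<^sub>0 g, of "-1"] by simp
    with deriv L1_norm_deriv_le_diff[OF h L1[OF k]]
    have "L1_norm M h \<le> L1_norm M (\<lambda>s. h s + (g\<^sub>0 s - g s))" by force
    then show "L1_norm M h \<le> L1_norm M (\<lambda>s. f s - g s)" by (simp add: h_def)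
  qed
  with best_approximants_iff[OF g\<^sub>0, of M f] show ?thesis by (simp add: h_def)
qed

section \<open>Splitting over the zero set and the criterion\<close>

lemma zero_set_measurable:
  assumes "h \<in> L1_space M"
  shows "zero_set M h \<in> sets M"
proof -
  have [measurable]: "(\<lambda>s. norm (h s)) \<in> borel_measurable M"
    using assms by (simp add: L1_space_def strongly_measurable_norm)
  have "{s \<in> space M. norm (h s) = 0} \<in> sets M" by measurable
  then show ?thesis by (simp add: zero_set_def)
qed

lemma integral_norm_deriv_split:
  assumes smooth: "smooth_space TYPE('a::complex_normed_vector)"
    and h: "(h :: 's \<Rightarrow> 'a) \<in> L1_space M" and k: "k \<in> L1_space M"
  shows "(LINT s|M. norm_deriv (h s) (k s)) =
    (LINT s:zero_set M h|M. norm (k s)) +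
    (LINT s:(space M - zero_set M h)|M. Re (support_map (h s) (k s)))"
proof -
  let ?Z = "zero_set M h" and ?d = "\<lambda>s. norm_deriv (h s) (k s)"
  note Z = zero_set_measurable[OF h]
  have "set_integrable M A ?d" if "A \<in> sets M" for A
    using integrable_mult_indicator[OF that integrable_norm_deriv[OF h k]]
    by (simp add: set_integrable_def)
  then have "(LINT s:?Z \<union> (space M - ?Z)|M. ?d s) =
      (LINT s:?Z|M. ?d s) + (LINT s:(space M - ?Z)|M. ?d s)"
    using Z by (intro set_integral_Un) auto
  moreover have "?Z \<union> (space M - ?Z) = space M"
    by (auto simp: zero_set_def)
  moreover have "(LINT s:space M|M. ?d s) = (LINT s|M. ?d s)"
    by (rule set_integral_space[OF integrable_norm_deriv[OF h k]])
  moreover have "(LINT s:?Z|M. ?d s) = (LINT s:?Z|M. norm (k s))"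
    using Z by (intro set_lebesgue_integral_cong) (auto simp: zero_set_def norm_deriv_zero_left)
  moreover have "(LINT s:(space M - ?Z)|M. ?d s) =
      (LINT s:(space M - ?Z)|M. Re (support_map (h s) (k s)))"
    using Z by (intro set_lebesgue_integral_cong) (auto simp: zero_set_def Re_support_map[OF smooth])
  ultimately show ?thesis by simp
qed

theorem theorem3p1:
  fixes M :: "'s measure"
    and G :: "('s \<Rightarrow> 'a::complex_banach) set"
    and f g\<^sub>0 :: "'s \<Rightarrow> 'a"
  assumes "smooth_space TYPE('a)"
    and "L1_subspace M G"
    and "f \<in> L1_space M - L1_closure M G"
    and "g\<^sub>0 \<in> G"
  shows "g\<^sub>0 \<in> best_approximants M G f \<longleftrightarrow>
    (\<forall>g\<in>G.
      \<bar>LINT s:(space M - zero_set M (\<lambda>s. f s - g\<^sub>0 s))|M. Re (support_map (f s - g\<^sub>0 s) (g s))\<bar>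
      \<le> (LINT s:zero_set M (\<lambda>s. f s - g\<^sub>0 s)|M. norm (g s)))"
proof -
  define h where "h = (\<lambda>s. f s - g\<^sub>0 s)"
  define A where "A k = (LINT s:(space M - zero_set M h)|M. Re (support_map (h s) (k s)))" for k
  define B where "B k = (LINT s:zero_set M h|M. norm (k s))" for k :: "'s \<Rightarrow> 'a"
  have L1: "k \<in> L1_space M" if "k \<in> G" for k
    using assms(2) that by (auto simp: L1_subspace_def)
  have f: "f \<in> L1_space M" using assms(3) by simp
  have h: "h \<in> L1_space M"
    using L1_space_add_scaleR[OF f L1[OF assms(4)], of "-1"] by (simp add: h_def)
  have "(\<lambda>s. 0) \<in> G" using assms(2) unfolding L1_subspace_def by blast
  then have minus: "(\<lambda>s. - k s) \<in> G" if "k \<in> G" for k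
    using L1_subspace_add_scaleR[OF assms(2) _ that, of "\<lambda>s. 0" "-1"] by simp
  have A_minus: "A (\<lambda>s. - k s) = - A k" for k
  proof -
    \<comment> \<open>Off the zero set the integrand is \<open>norm_deriv (h s) (k s)\<close>, which
      is odd in the direction by smoothness.\<close>
    have "A (\<lambda>s. - k s) = (LINT s:(space M - zero_set M h)|M. - Re (support_map (h s) (k s)))"
      unfolding A_def using zero_set_measurable[OF h]
      by (intro set_lebesgue_integral_cong)
        (auto simp: zero_set_def Re_support_map[OF assms(1)] norm_deriv_minus[OF assms(1)])
    then show ?thesis by (simp add: A_def set_lebesgue_integral_def)
  qed
  have B_minus: "B (\<lambda>s. - k s) = B k" for k by (simp add: B_def)
  have split: "(LINT s|M. norm_deriv (f s - g\<^sub>0 s) (k s)) = B k + A k" if "k \<in> G" for k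
    using integral_norm_deriv_split[OF assms(1) h L1[OF that]] by (simp add: h_def A_def B_def)
  have "g\<^sub>0 \<in> best_approximants M G f \<longleftrightarrow> (\<forall>k\<in>G. 0 \<le> B k + A k)"
    by (simp add: best_approximants_iff_norm_deriv[OF assms(2) f assms(4)] split)
  also have "\<dots> \<longleftrightarrow> (\<forall>k\<in>G. \<bar>A k\<bar> \<le> B k)"
  proof (intro iffI ballI)
    fix k assume "\<forall>k\<in>G. 0 \<le> B k + A k" and k: "k \<in> G"
    \<comment> \<open>The directions \<open>k\<close> and \<open>- k\<close> give the bounds
      \<open>- B k \<le> A k\<close> and \<open>A k \<le> B k\<close>.\<close>
    then have "0 \<le> B k + A k" "0 \<le> B (\<lambda>s. - k s) + A (\<lambda>s. - k s)" using minus by blast+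
    then show "\<bar>A k\<bar> \<le> B k" by (simp add: A_minus B_minus)
  next
    fix k assume "\<forall>k\<in>G. \<bar>A k\<bar> \<le> B k" and "k \<in> G"
    then have "\<bar>A k\<bar> \<le> B k" by blast
    then show "0 \<le> B k + A k" by simp
  qed
  finally show ?thesis by (simp add: A_def B_def h_def)
qed

end
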